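(* Let $\phi(y)=\sum_{j=0}^R\phi_jy^j$ be a nonzero polynomial. Define $$\Phi(y):=\int_{y_0}^y\frac{d\tau}{\phi(\tau)},$$ where $y_0$ is an arbitrary nonnegative constant chosen so that $\phi(y_0)\neq0$. Let $T\equiv T^\phi(z,u)$ be defined as the solution of $$\Phi(T+u)-\Phi(u)=z,\qquad T(0,u)=0 .$$ Then the multivariate exponential generating function of all labelled diagrams relative to $\phi(X)D$ is $$G(z;u,v)=\exp\bigl(v\,T^\phi(z,u)\bigr).$$
   Context: Labelled diagrams relative to $\phi(X)D=\sum_j\phi_jX^jD$: a labelled diagram of size $n$ has inner nodes (gates) labelled $1,\dots,n$, each being an $X^jD$-gate for some $0\le j\le R$ (one input slot and $j$ ordered, distinguishable output slots), such a gate having weight $\phi_j$, together with a set of connections, each joining an output slot of a node $i$ to the input slot of a node $i'$ with $i<i'$, every slot being used at most once. Unconnected output slots are the outputs, unconnected input slots the inputs. The weight of a diagram is the product of the weights of its gates. $G(z;u,v)=\sum_{n,a,b}c_{n,a,b}u^av^b\frac{z^n}{n!}$, where $c_{n,a,b}$ is the total weight of labelled diagrams of size $n$ with $a$ outputs and $b$ inputs. (Equivalently, when $DX-XD=1$, $c_{n,a,b}$ is the coefficient of $X^aD^b$ in the normal form of $(\phi(X)D)^n$, all $X$'s being to the left of all $D$'s.) $T(z,u)$ is understood as a formal power series in $z$ whose coefficients depend on $u$, viewed as a parameter; the defining equation amounts to $\int_0^{T(z,u)}\frac{d\tau}{\phi(u+\tau)}=z$. *)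

theory Defs
  imports "HOL-Complex_Analysis.Complex_Analysis"
begin

text \<open>
  A labelled diagram of size \<open>n\<close> is a pair \<open>(J, E)\<close>: node \<open>i \<in> {1..n}\<close> is an \<open>X\<^sup>jD\<close>-gate with
  \<open>j = J i\<close>, whose ordered output slots are the pairs \<open>(i, k)\<close> with \<open>k < J i\<close> and whose single
  input slot is identified with \<open>i\<close> itself; \<open>((i, k), i') \<in> E\<close> is a connection from output
  slot \<open>(i, k)\<close> to the input slot of \<open>i'\<close>.  The two injectivity conditions say that every slot
  is used at most once.
\<close>

type_synonym diagram = "(nat \<Rightarrow> nat) \<times> ((nat \<times> nat) \<times> nat) set"

definition output_slots :: "nat \<Rightarrow> (nat \<Rightarrow> nat) \<Rightarrow> (nat \<times> nat) set" where
  "output_slots n J = (SIGMA i:{1..n}. {..<J i})"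

definition diagrams :: "nat \<Rightarrow> nat \<Rightarrow> diagram set" where
  "diagrams R n = {(J, E). J \<in> {1..n} \<rightarrow>\<^sub>E {0..R} \<and>
     E \<subseteq> output_slots n J \<times> {1..n} \<and> (\<forall>((i, k), i') \<in> E. i < i') \<and>
     inj_on fst E \<and> inj_on snd E}"

definition outputs :: "nat \<Rightarrow> diagram \<Rightarrow> (nat \<times> nat) set" where
  "outputs n = (\<lambda>(J, E). output_slots n J - fst ` E)"

definition inputs :: "nat \<Rightarrow> diagram \<Rightarrow> nat set" where
  "inputs n = (\<lambda>(J, E). {1..n} - snd ` E)"

definition weight :: "complex poly \<Rightarrow> nat \<Rightarrow> diagram \<Rightarrow> complex" where
  "weight \<phi> n = (\<lambda>(J, E). \<Prod>i\<in>{1..n}. coeff \<phi> (J i))"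

definition total_weight :: "complex poly \<Rightarrow> nat \<Rightarrow> nat \<Rightarrow> nat \<Rightarrow> nat \<Rightarrow> complex" where
  "total_weight \<phi> R n a b =
     (\<Sum>d | d \<in> diagrams R n \<and> card (outputs n d) = a \<and> card (inputs n d) = b. weight \<phi> n d)"

text \<open>
  The exponential generating function as a power series in \<open>z\<close>, at parameter values \<open>u\<close> and \<open>v\<close>.
  A diagram of size \<open>n\<close> has at most \<open>R * n\<close> outputs and \<open>n\<close> inputs, so the coefficient of
  \<open>z\<^sup>n\<close> is a polynomial in \<open>u\<close>, \<open>v\<close> and the ranges of summation below lose nothing.
\<close>

definition diagram_egf :: "complex poly \<Rightarrow> nat \<Rightarrow> complex \<Rightarrow> complex \<Rightarrow> complex fps" where
  "diagram_egf \<phi> R u v =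
     Abs_fps (\<lambda>n. (\<Sum>a\<le>R * n. \<Sum>b\<le>n. total_weight \<phi> R n a b * u ^ a * v ^ b) / fact n)"

text \<open>
  The integral of \<open>1 / \<phi>\<close> from \<open>y\<^sub>0\<close> to \<open>y\<close>, for \<open>y\<close> near a point \<open>u\<close> with \<open>\<phi>(u) \<noteq> 0\<close>, is taken
  along a path \<open>\<gamma>\<close> from \<open>y\<^sub>0\<close> to \<open>u\<close> avoiding the zeros of \<open>\<phi>\<close>, followed by the segment from
  \<open>u\<close> to \<open>y\<close>.  Different choices of \<open>\<gamma>\<close> give branches that differ by a constant near \<open>u\<close>.
\<close>

definition Phi :: "complex poly \<Rightarrow> (real \<Rightarrow> complex) \<Rightarrow> complex \<Rightarrow> complex" where
  "Phi \<phi> \<gamma> y = contour_integral (\<gamma> +++ linepath (pathfinish \<gamma>) y) (\<lambda>\<tau>. 1 / poly \<phi> \<tau>)"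

text \<open>
  The equation \<open>\<Phi>(T + u) - \<Phi>(u) = z\<close> with \<open>T(0) = 0\<close> for a formal power series \<open>T\<close> in \<open>z\<close>:
  as \<open>T\<close> has no constant term, \<open>\<Phi>(T + u)\<close> is the composition of the Taylor series of \<open>\<Phi>\<close> at
  \<open>u\<close> with \<open>T\<close>.
\<close>

definition is_T :: "complex poly \<Rightarrow> (real \<Rightarrow> complex) \<Rightarrow> complex \<Rightarrow> complex fps \<Rightarrow> bool" where
  "is_T \<phi> \<gamma> u T \<longleftrightarrow>
     fps_nth T 0 = 0 \<and>
     fps_compose (fps_expansion (Phi \<phi> \<gamma>) u) T - fps_const (Phi \<phi> \<gamma> u) = fps_X"

end

theory Submission
  imports Defs
begin

text \<open>
  The last node of a diagram can feed no other node, so a diagram of size \<open>n + 1\<close> is a diagram of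
  size \<open>n\<close> together with a choice of gate \<open>X\<^sup>jD\<close> for the last node and a choice of where its input
  slot goes: it stays free, or it takes up one of the current outputs. Fix \<open>v\<close> and let \<open>Q\<^sub>n(y)\<close> be
  the total weight of the diagrams of size \<open>n\<close>, with \<open>y\<close> marking outputs and \<open>v\<close> marking inputs. A
  free input slot contributes a factor \<open>v\<close>, taking up one of \<open>a\<close> outputs turns \<open>y\<^sup>a\<close> into
  \<open>a y\<^sup>a\<^sup>-\<^sup>1\<close>, and the new outputs contribute \<open>\<phi>(y)\<close>. Hence \<open>Q\<^sub>0 = 1\<close> and
  \<open>Q\<^sub>n\<^sub>+\<^sub>1 = \<phi> \<sqdot> (v Q\<^sub>n + Q\<^sub>n')\<close> (\<open>diagram_poly_Suc\<close>), and the coefficient of \<open>z\<^sup>n\<close> in the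
  generating function is \<open>Q\<^sub>n(u) / n!\<close> (\<open>diagram_egf_nth\<close>).

  On the analytic side \<open>\<Phi>' = 1 / \<phi>\<close> near \<open>u\<close>, so differentiating \<open>\<Phi>(u + T) - \<Phi>(u) = z\<close> in \<open>z\<close>
  shows that \<open>u + T\<close> is the flow of the vector field \<open>\<phi>\<close> started at \<open>u\<close>: \<open>T' = \<phi>(u + T)\<close>.
  Therefore every derivative in \<open>z\<close> of \<open>Q(u + T) exp(v T)\<close> replaces \<open>Q\<close> by \<open>\<phi> \<sqdot> (v Q + Q')\<close>. This is
  the recurrence above, so the \<open>n\<close>-th derivative of \<open>exp(v T)\<close> is \<open>Q\<^sub>n(u + T) exp(v T)\<close>
  (\<open>fps_nth_deriv_exp_flow\<close>). At \<open>z = 0\<close> its value is \<open>Q\<^sub>n(u)\<close>, and Taylor's formula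
  identifies \<open>exp(v T)\<close> with the generating function. Only derivatives in \<open>z\<close> occur, which is why \<open>u\<close>
  can remain a fixed complex number throughout.

  Existence and uniqueness of \<open>T\<close> hold because \<open>\<Phi>(u + X) - \<Phi>(u)\<close> has no constant term and linear
  coefficient \<open>1 / \<phi>(u) \<noteq> 0\<close>, so that it has a compositional inverse.
\<close>


section \<open>Attaching the last gate of a diagram\<close>

text \<open>
  The option is the output slot that feeds the new gate, \<open>None\<close> standing for a free input slot. It
  enters only through \<open>set_option\<close>, so that both cases are covered by one formula.
\<close>

definition attach_gate :: "nat \<Rightarrow> diagram \<times> nat \<times> (nat \<times> nat) option \<Rightarrow> diagram" where
  "attach_gate n = (\<lambda>((J, E), j, c). (J(Suc n := j), E \<union> set_option c \<times> {Suc n}))"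

definition attachments :: "nat \<Rightarrow> nat \<Rightarrow> (diagram \<times> nat \<times> (nat \<times> nat) option) set" where
  "attachments R n = (SIGMA d:diagrams R n. {0..R} \<times> insert None (Some ` outputs n d))"

lemma finite_output_slots [simp]: "finite (output_slots n J)"
  by (simp add: output_slots_def)

lemma finite_outputs [simp]: "finite (outputs n d)"
  by (cases d) (simp add: outputs_def)

lemma finite_inputs [simp]: "finite (inputs n d)"
  by (cases d) (simp add: inputs_def)

lemma output_slots_less: "s \<in> output_slots n J \<Longrightarrow> fst s < Suc n"
  by (auto simp: output_slots_def)

lemma output_slots_Suc:
  "output_slots (Suc n) (J(Suc n := j)) = output_slots n J \<union> {Suc n} \<times> {..<j}"
  by (auto simp: output_slots_def less_Suc_eq_le le_Suc_eq)

lemma finite_diagrams: "finite (diagrams R n)"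
proof (rule finite_subset)
  show "diagrams R n \<subseteq> (SIGMA J:{1..n} \<rightarrow>\<^sub>E {0..R}. Pow (output_slots n J \<times> {1..n}))"
    by (auto simp: diagrams_def)
  show "finite (SIGMA J:{1..n} \<rightarrow>\<^sub>E {0..R}. Pow (output_slots n J \<times> {1..n}))"
    by (intro finite_SigmaI finite_PiE) auto
qed

lemma card_outputs_le:
  assumes "d \<in> diagrams R n"
  shows "card (outputs n d) \<le> R * n"
proof -
  obtain J E where d: "d = (J, E)" by fastforce
  have "card (outputs n d) \<le> card (output_slots n J)"
    unfolding d outputs_def by (auto intro: card_mono)
  also have "\<dots> = (\<Sum>i\<in>{1..n}. J i)"
    by (simp add: output_slots_def)
  also have "\<dots> \<le> (\<Sum>i\<in>{1..n}. R)"
    using assms by (intro sum_mono) (auto simp: d diagrams_def)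
  finally show ?thesis by (simp add: mult.commute)
qed

lemma card_inputs_le: "card (inputs n d) \<le> n"
  using card_mono[of "{1..n}" "inputs n d"] by (cases d) (auto simp: inputs_def)

text \<open>
  Everything is recovered from the enlarged diagram: the old gate map is \<open>undefined\<close> at \<open>n + 1\<close>, and
  the connections added last are exactly those that end in \<open>n + 1\<close>.
\<close>

lemma inj_on_attach_gate: "inj_on (attach_gate n) (attachments R n)"
proof (rule inj_onI)
  fix p q
  assume p: "p \<in> attachments R n" and q: "q \<in> attachments R n"
    and eq: "attach_gate n p = attach_gate n q"
  obtain J E j c J' E' j' c' where pq: "p = ((J, E), j, c)" "q = ((J', E'), j', c')"
    by (metis prod.collapse)
  have J: "J (Suc n) = undefined" "J' (Suc n) = undefined"
    and E: "snd ` E \<subseteq> {1..n}" "snd ` E' \<subseteq> {1..n}"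
    using p q unfolding pq attachments_def diagrams_def by (auto simp: PiE_def extensional_def)
  have eqJ: "J(Suc n := j) = J'(Suc n := j')"
    and eqE: "E \<union> set_option c \<times> {Suc n} = E' \<union> set_option c' \<times> {Suc n}"
    using eq by (simp_all add: pq attach_gate_def)
  have "J = J'"
    using eqJ J by (metis fun_upd_triv fun_upd_upd)
  moreover have "j = j'"
    using eqJ by (metis fun_upd_same)
  moreover have "E = E'"
  proof -
    have "E = {e \<in> E \<union> set_option c \<times> {Suc n}. snd e \<le> n}" using E by force
    also have "\<dots> = E'" unfolding eqE using E by force
    finally show ?thesis .
  qed
  moreover have "set_option c = set_option c'"
  proof -
    have "set_option c = {s. (s, Suc n) \<in> E \<union> set_option c \<times> {Suc n}}" using E by force
    also have "\<dots> = set_option c'" unfolding eqE using E by force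
    finally show ?thesis .
  qed
  then have "c = c'" by (cases c; cases c') auto
  ultimately show "p = q" by (simp add: pq)
qed

lemma attach_gate_in_diagrams:
  assumes "p \<in> attachments R n"
  shows "attach_gate n p \<in> diagrams R (Suc n)"
proof -
  obtain J E j c where p: "p = ((J, E), j, c)" by (metis prod.collapse)
  have d: "(J, E) \<in> diagrams R n" and j: "j \<le> R" and c: "set_option c \<subseteq> outputs n (J, E)"
    using assms by (auto simp: p attachments_def)
  have J: "J \<in> {1..n} \<rightarrow>\<^sub>E {0..R}" and E: "E \<subseteq> output_slots n J \<times> {1..n}"
    "\<forall>((i, k), i') \<in> E. i < i'" "inj_on fst E" "inj_on snd E"
    using d by (auto simp: diagrams_def)
  have "J(Suc n := j) \<in> {1..Suc n} \<rightarrow>\<^sub>E {0..R}"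
    using J j by (auto simp: PiE_def extensional_def Pi_def le_Suc_eq)
  moreover have "E \<union> set_option c \<times> {Suc n} \<subseteq> output_slots (Suc n) (J(Suc n := j)) \<times> {1..Suc n}"
    using E(1) c unfolding output_slots_Suc by (force simp: outputs_def)
  moreover have "\<forall>((i, k), i') \<in> E \<union> set_option c \<times> {Suc n}. i < i'"
    using E(2) c output_slots_less[of _ n J] by (fastforce simp: outputs_def)
  moreover have "inj_on fst (E \<union> set_option c \<times> {Suc n})"
    using E(3) c by (cases c) (auto simp: outputs_def)
  moreover have "inj_on snd (E \<union> set_option c \<times> {Suc n})"
    using E(1,4) c by (cases c) auto
  ultimately show ?thesis
    by (simp add: p attach_gate_def diagrams_def)
qed

text \<open>
  Deleting the last node leaves a diagram because that node feeds no other one; what is deleted is a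
  gate and at most one connection, as its only input slot is used at most once.
\<close>

lemma diagrams_Suc_subset: "diagrams R (Suc n) \<subseteq> attach_gate n ` attachments R n"
proof
  fix d' assume d': "d' \<in> diagrams R (Suc n)"
  obtain J' E' where d'_eq: "d' = (J', E')" by fastforce
  have J': "J' \<in> {1..Suc n} \<rightarrow>\<^sub>E {0..R}" and E': "E' \<subseteq> output_slots (Suc n) J' \<times> {1..Suc n}"
    and lt: "\<And>i k i'. ((i, k), i') \<in> E' \<Longrightarrow> i < i'" and inj: "inj_on fst E'" "inj_on snd E'"
    using d' by (auto simp: d'_eq diagrams_def)
  define J where "J = J'(Suc n := undefined)"
  define E where "E = {e \<in> E'. snd e \<noteq> Suc n}"
  have J'_eq: "J(Suc n := J' (Suc n)) = J'" by (simp add: J_def)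
  have slots: "output_slots (Suc n) J' = output_slots n J \<union> {Suc n} \<times> {..<J' (Suc n)}"
    using output_slots_Suc[of n J "J' (Suc n)"] unfolding J'_eq .
  have J: "J \<in> {1..n} \<rightarrow>\<^sub>E {0..R}"
  proof (rule PiE_I)
    show "J i \<in> {0..R}" if "i \<in> {1..n}" for i
      using PiE_mem[OF J', of i] that by (simp add: J_def)
    show "J i = undefined" if "i \<notin> {1..n}" for i
      using PiE_arb[OF J', of i] that by (cases "i = Suc n") (auto simp: J_def)
  qed
  \<comment> \<open>Connections increase the label, so none of them leaves the last node.\<close>
  have src: "s \<in> output_slots n J" if "(s, i) \<in> E'" for s i
  proof -
    have "fst s < i" "i \<le> Suc n" using that lt[of "fst s" "snd s" i] E' by auto
    then show ?thesis using that E' unfolding slots by auto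
  qed
  have "(J, E) \<in> diagrams R n"
  proof -
    have "E \<subseteq> E'" by (auto simp: E_def)
    then have "inj_on fst E" "inj_on snd E"
      using inj_on_subset[OF inj(1)] inj_on_subset[OF inj(2)] by blast+
    moreover have "E \<subseteq> output_slots n J \<times> {1..n}"
    proof
      fix e assume e: "e \<in> E"
      then have "(fst e, snd e) \<in> E'" by (simp add: E_def)
      then show "e \<in> output_slots n J \<times> {1..n}"
        using src[of "fst e" "snd e"] E' e by (cases e) (auto simp: E_def le_Suc_eq)
    qed
    moreover have "\<forall>((i, k), i') \<in> E. i < i'"
      using lt by (auto simp: E_def)
    ultimately show ?thesis using J by (simp add: diagrams_def)
  qed
  obtain c where c: "set_option c \<times> {Suc n} = {e \<in> E'. snd e = Suc n}"
  proof (cases "\<exists>s. (s, Suc n) \<in> E'")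
    case True
    then obtain s where s: "(s, Suc n) \<in> E'" by blast
    have "{e \<in> E'. snd e = Suc n} = {(s, Suc n)}"
    proof (intro equalityI subsetI)
      fix e assume "e \<in> {e \<in> E'. snd e = Suc n}"
      then show "e \<in> {(s, Suc n)}" using inj_onD[OF inj(2), of e "(s, Suc n)"] s by simp
    qed (use s in simp)
    then have "set_option (Some s) \<times> {Suc n} = {e \<in> E'. snd e = Suc n}"
      by simp
    then show thesis by (rule that)
  next
    case False
    then have "set_option None \<times> {Suc n} = {e \<in> E'. snd e = Suc n}" by auto
    then show thesis by (rule that)
  qed
  have c_out: "set_option c \<subseteq> outputs n (J, E)"
  proof
    fix s assume "s \<in> set_option c"
    then have "(s, Suc n) \<in> set_option c \<times> {Suc n}" by simp
    then have s: "(s, Suc n) \<in> E'" unfolding c by simp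
    have "s \<notin> fst ` E"
    proof
      assume "s \<in> fst ` E"
      then obtain e where "e \<in> E'" "snd e \<noteq> Suc n" "fst e = s"
        unfolding E_def by blast
      then show False
        using inj_onD[OF inj(1), of e "(s, Suc n)"] s by simp
    qed
    then show "s \<in> outputs n (J, E)" using src[OF s] by (simp add: outputs_def)
  qed
  have "((J, E), J' (Suc n), c) \<in> attachments R n"
  proof -
    have "J' (Suc n) \<in> {0..R}" using PiE_mem[OF J', of "Suc n"] by simp
    moreover have "c \<in> insert None (Some ` outputs n (J, E))"
      using c_out by (cases c) simp_all
    ultimately show ?thesis
      using \<open>(J, E) \<in> diagrams R n\<close> unfolding attachments_def by blast
  qed
  moreover have "d' = attach_gate n ((J, E), J' (Suc n), c)"
  proof -
    have "E \<union> {e \<in> E'. snd e = Suc n} = E'" unfolding E_def by blast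
    then show ?thesis by (simp only: d'_eq attach_gate_def prod.case J'_eq c)
  qed
  ultimately show "d' \<in> attach_gate n ` attachments R n" by (rule rev_image_eqI)
qed

lemma bij_betw_attach_gate: "bij_betw (attach_gate n) (attachments R n) (diagrams R (Suc n))"
  using inj_on_attach_gate attach_gate_in_diagrams diagrams_Suc_subset
  unfolding bij_betw_def by blast

lemma weight_attach_gate:
  "weight \<phi> (Suc n) (attach_gate n (d, j, c)) = coeff \<phi> j * weight \<phi> n d"
  by (cases d) (simp add: attach_gate_def weight_def)

lemma card_inputs_attach_gate:
  assumes "(d, j, c) \<in> attachments R n"
  shows "card (inputs (Suc n) (attach_gate n (d, j, c))) =
         card (inputs n d) + (if c = None then 1 else 0)"
proof -
  obtain J E where d: "d = (J, E)" by fastforce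
  have E: "snd ` E \<subseteq> {1..n}"
    using assms by (auto simp: d attachments_def diagrams_def)
  have "inputs (Suc n) (attach_gate n (d, j, c)) =
        (if c = None then insert (Suc n) (inputs n d) else inputs n d)"
    using E by (cases c) (auto simp: d attach_gate_def inputs_def image_Un le_Suc_eq)
  moreover have "Suc n \<notin> inputs n d" by (simp add: d inputs_def)
  ultimately show ?thesis by simp
qed

lemma card_outputs_attach_gate:
  assumes "(d, j, c) \<in> attachments R n"
  shows "card (outputs (Suc n) (attach_gate n (d, j, c))) =
         card (outputs n d) - (if c = None then 0 else 1) + j"
proof -
  obtain J E where d: "d = (J, E)" by fastforce
  have E: "fst ` E \<subseteq> output_slots n J" and c: "set_option c \<subseteq> outputs n d"
    using assms by (auto simp: d attachments_def diagrams_def)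
  have new: "({Suc n} \<times> {..<j}) \<inter> output_slots n J = {}"
    by (auto simp: output_slots_def)
  have diff_Un: "A \<union> N - (F \<union> C) = (A - F - C) \<union> N"
    if "N \<inter> A = {}" "F \<subseteq> A" "C \<subseteq> A" for A C F N :: "(nat \<times> nat) set"
    using that by blast
  have "set_option c \<subseteq> output_slots n J"
    using c by (auto simp: d outputs_def)
  from diff_Un[OF new E this] have "output_slots n J \<union> {Suc n} \<times> {..<j} - (fst ` E \<union> set_option c) =
      (output_slots n J - fst ` E - set_option c) \<union> {Suc n} \<times> {..<j}" .
  moreover have "fst ` (E \<union> set_option c \<times> {Suc n}) = fst ` E \<union> set_option c"
    by (cases c) simp_all
  ultimately have "outputs (Suc n) (attach_gate n (d, j, c)) =
      (outputs n d - set_option c) \<union> {Suc n} \<times> {..<j}"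
    by (simp only: d attach_gate_def outputs_def prod.case output_slots_Suc)
  also have "card \<dots> = card (outputs n d - set_option c) + card ({Suc n} \<times> {..<j})"
  proof (rule card_Un_disjoint)
    have "outputs n d \<subseteq> output_slots n J" by (auto simp: d outputs_def)
    then show "(outputs n d - set_option c) \<inter> ({Suc n} \<times> {..<j}) = {}"
      using new by blast
  qed simp_all
  also have "card (outputs n d - set_option c) = card (outputs n d) - card (set_option c)"
    using c by (intro card_Diff_subset) simp_all
  also have "card (set_option c) = (if c = None then 0 else 1)"
    by (cases c) auto
  finally show ?thesis by (simp add: card_cartesian_product)
qed

section \<open>The recurrence for the diagram polynomials\<close>

text \<open>
  Outputs are marked by the polynomial variable, as the recurrence differentiates with respect to it,
  while the marker of the inputs is only a parameter.
\<close>

definition diagram_poly :: "complex poly \<Rightarrow> nat \<Rightarrow> complex \<Rightarrow> nat \<Rightarrow> complex poly" where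
  "diagram_poly \<phi> R v n =
     (\<Sum>d\<in>diagrams R n. monom (weight \<phi> n d * v ^ card (inputs n d)) (card (outputs n d)))"

lemma diagram_poly_0: "diagram_poly \<phi> R v 0 = 1"
proof -
  have "diagrams R 0 = {(\<lambda>_. undefined, {})}"
    by (auto simp: diagrams_def output_slots_def)
  then show ?thesis
    by (simp add: diagram_poly_def weight_def inputs_def outputs_def output_slots_def)
qed

text \<open>
  Multiplication by \<open>v\<close> leaves the input slot of the new gate free; the derivative selects the output
  that feeds it. In operator form, \<open>Q\<^sub>n = (\<phi> \<sqdot> (v + d/dy))\<^sup>n 1\<close>, which is what \<open>(\<phi>(X)D)\<^sup>n\<close> does to
  \<open>e\<^sup>v\<^sup>y\<close>, up to that factor.
\<close>

lemma diagram_poly_Suc: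
  assumes "degree \<phi> \<le> R"
  shows "diagram_poly \<phi> R v (Suc n) =
         \<phi> * (smult v (diagram_poly \<phi> R v n) + pderiv (diagram_poly \<phi> R v n))"
proof -
  define diag_monom where "diag_monom = (\<lambda>n d. monom (weight \<phi> n d * v ^ card (inputs n d)) (card (outputs n d)))"
  have poly_eq: "diagram_poly \<phi> R v n = (\<Sum>d\<in>diagrams R n. diag_monom n d)" for n
    by (simp add: diagram_poly_def diag_monom_def)
  have "diagram_poly \<phi> R v (Suc n) = (\<Sum>p\<in>attachments R n. diag_monom (Suc n) (attach_gate n p))"
    unfolding poly_eq
    by (rule sum.reindex_bij_betw[OF bij_betw_attach_gate, symmetric])
  also have "\<dots> = (\<Sum>d\<in>diagrams R n. \<Sum>j\<in>{0..R}. \<Sum>c\<in>insert None (Some ` outputs n d).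
                     diag_monom (Suc n) (attach_gate n (d, j, c)))"
    unfolding attachments_def
    by (simp add: finite_diagrams sum.Sigma sum.cartesian_product case_prod_unfold
        del: sum.insert)
  also have "\<dots> = (\<Sum>d\<in>diagrams R n. \<Sum>j\<in>{0..R}. monom (coeff \<phi> j) j *
                     (smult v (diag_monom n d) + pderiv (diag_monom n d)))"
  proof (intro sum.cong refl)
    fix d j assume d: "d \<in> diagrams R n" and j: "j \<in> {0..R}"
    let ?a = "card (outputs n d)" and ?w = "weight \<phi> n d * v ^ card (inputs n d)"
    have att: "(d, j, c) \<in> attachments R n" if "c \<in> insert None (Some ` outputs n d)" for c
      using d j that by (auto simp: attachments_def)
    then have att_Some: "(d, j, Some s) \<in> attachments R n" if "s \<in> outputs n d" for s
      using that by blast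
    have "(\<Sum>c\<in>insert None (Some ` outputs n d). diag_monom (Suc n) (attach_gate n (d, j, c))) =
          diag_monom (Suc n) (attach_gate n (d, j, None)) +
          (\<Sum>s\<in>outputs n d. diag_monom (Suc n) (attach_gate n (d, j, Some s)))"
      by (subst sum.insert) (auto simp: sum.reindex)
    also have "diag_monom (Suc n) (attach_gate n (d, j, None)) = monom (coeff \<phi> j * (v * ?w)) (j + ?a)"
      using att[of None]
      by (simp add: diag_monom_def weight_attach_gate card_inputs_attach_gate card_outputs_attach_gate
          algebra_simps)
    also have "(\<Sum>s\<in>outputs n d. diag_monom (Suc n) (attach_gate n (d, j, Some s))) =
               (\<Sum>s\<in>outputs n d. monom (coeff \<phi> j * ?w) (j + (?a - 1)))"
      by (intro sum.cong refl) (simp add: diag_monom_def weight_attach_gate algebra_simps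
          card_inputs_attach_gate[OF att_Some] card_outputs_attach_gate[OF att_Some])
    also have "\<dots> = monom (coeff \<phi> j * (of_nat ?a * ?w)) (j + (?a - 1))"
      by (simp add: of_nat_monom mult_monom mult_ac)
    finally show "(\<Sum>c\<in>insert None (Some ` outputs n d). diag_monom (Suc n) (attach_gate n (d, j, c))) =
        monom (coeff \<phi> j) j * (smult v (diag_monom n d) + pderiv (diag_monom n d))"
      by (simp add: diag_monom_def smult_monom pderiv_monom distrib_left mult_monom)
  qed
  also have "\<dots> = (\<Sum>j\<in>{0..R}. monom (coeff \<phi> j) j) *
                  (\<Sum>d\<in>diagrams R n. smult v (diag_monom n d) + pderiv (diag_monom n d))"
    by (simp only: sum_distrib_left[symmetric] sum_distrib_right[symmetric])
  also have "(\<Sum>j\<in>{0..R}. monom (coeff \<phi> j) j) = \<phi>"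
    using poly_as_sum_of_monoms'[OF assms] by (simp add: atMost_atLeast0)
  also have "(\<Sum>d\<in>diagrams R n. smult v (diag_monom n d) + pderiv (diag_monom n d)) =
             smult v (diagram_poly \<phi> R v n) + pderiv (diagram_poly \<phi> R v n)"
    using sum_distrib_left[of "[:v:]" "diag_monom n" "diagrams R n"]
      higher_pderiv_sum[of 1 "diag_monom n" "diagrams R n"]
    by (simp add: poly_eq sum.distrib)
  finally show ?thesis .
qed

lemma diagram_egf_nth: "fps_nth (diagram_egf \<phi> R u v) n = poly (diagram_poly \<phi> R v n) u / fact n"
proof -
  let ?w = "\<lambda>d. weight \<phi> n d * u ^ card (outputs n d) * v ^ card (inputs n d)"
  let ?S = "\<lambda>a b. {d \<in> diagrams R n. card (outputs n d) = a \<and> card (inputs n d) = b}"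
  have "(\<Sum>a\<le>R * n. \<Sum>b\<le>n. total_weight \<phi> R n a b * u ^ a * v ^ b) =
        (\<Sum>p\<in>{..R * n} \<times> {..n}. sum ?w
           {d \<in> diagrams R n. (card (outputs n d), card (inputs n d)) = p})"
    unfolding sum.cartesian_product total_weight_def sum_distrib_right
    by (intro sum.cong refl) (auto intro!: sum.cong)
  also have "\<dots> = sum ?w (diagrams R n)"
    by (rule sum.group) (auto simp: finite_diagrams card_outputs_le card_inputs_le)
  also have "\<dots> = poly (diagram_poly \<phi> R v n) u"
    by (simp add: diagram_poly_def poly_sum poly_monom mult_ac)
  finally show ?thesis by (simp add: diagram_egf_def)
qed

section \<open>The flow of a polynomial vector field\<close>

text \<open>
  Substitution of \<open>u + T\<close> into a polynomial is split into a shift and a composition of power series,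
  so that the chain rule for composition applies although \<open>u + T\<close> may have a constant term.
\<close>

definition shift_poly_fps :: "complex poly \<Rightarrow> complex \<Rightarrow> complex fps" where
  "shift_poly_fps p u = fps_of_poly (p \<circ>\<^sub>p [:u, 1:])"

lemma shift_poly_fps_mult: "shift_poly_fps (p * q) u = shift_poly_fps p u * shift_poly_fps q u"
  by (simp add: shift_poly_fps_def pcompose_mult fps_of_poly_mult)

lemma shift_poly_fps_add: "shift_poly_fps (p + q) u = shift_poly_fps p u + shift_poly_fps q u"
  by (simp add: shift_poly_fps_def pcompose_add fps_of_poly_add)

lemma shift_poly_fps_smult: "shift_poly_fps (smult c p) u = fps_const c * shift_poly_fps p u"
  by (simp add: shift_poly_fps_def pcompose_smult fps_of_poly_smult)

lemma fps_deriv_shift_poly_fps: "fps_deriv (shift_poly_fps p u) = shift_poly_fps (pderiv p) u"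
  by (simp add: shift_poly_fps_def fps_of_poly_pderiv[symmetric] pderiv_pcompose pderiv_pCons)

lemma shift_poly_fps_nth_0: "fps_nth (shift_poly_fps p u) 0 = poly p u"
  by (simp add: shift_poly_fps_def poly_0_coeff_0[symmetric] poly_pcompose)

lemma has_fps_expansion_shift_poly_fps: "(\<lambda>x. poly p (u + x)) has_fps_expansion shift_poly_fps p u"
proof -
  have "poly q has_fps_expansion fps_of_poly q" for q :: "complex poly"
    by (induction q) (auto simp: fps_of_poly_pCons add.commute mult.commute intro!: fps_expansion_intros)
  moreover have "poly (p \<circ>\<^sub>p [:u, 1:]) = (\<lambda>x. poly p (u + x))"
    by (simp add: fun_eq_iff poly_pcompose)
  ultimately show ?thesis
    unfolding shift_poly_fps_def by metis
qed

text \<open>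
  By the chain rule and \<open>T' = \<phi>(u + T)\<close>, the derivative of \<open>Q(u + T) exp(v T)\<close> is
  \<open>\<phi>(u + T) (Q' + v Q)(u + T) exp(v T)\<close>: one more derivative amounts to one more gate.
\<close>

lemma fps_nth_deriv_exp_flow:
  assumes "degree \<phi> \<le> R" and T0: "fps_nth T 0 = 0"
    and T': "fps_deriv T = fps_compose (shift_poly_fps \<phi> u) T"
  shows "fps_nth_deriv n (fps_compose (fps_exp 1) (fps_const v * T)) =
         fps_compose (shift_poly_fps (diagram_poly \<phi> R v n) u) T *
         fps_compose (fps_exp 1) (fps_const v * T)"
proof (induction n)
  case 0
  then show ?case by (simp add: diagram_poly_0 shift_poly_fps_def pcompose_1)
next
  case (Suc n)
  define Q where "Q = diagram_poly \<phi> R v n"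
  let ?C = "\<lambda>p. fps_compose (shift_poly_fps p u) T"
  let ?E = "fps_compose (fps_exp 1) (fps_const v * T)"
  have "fps_nth (fps_const v * T) 0 = 0" using T0 by simp
  then have deriv_E: "fps_deriv ?E = fps_const v * ?C \<phi> * ?E"
    by (simp add: fps_compose_deriv T' mult_ac)
  have deriv_C: "fps_deriv (?C Q) = ?C (pderiv Q) * ?C \<phi>"
    by (simp add: fps_compose_deriv[OF T0] T' fps_deriv_shift_poly_fps)
  have "?C (\<phi> * (smult v Q + pderiv Q)) = ?C \<phi> * (fps_const v * ?C Q + ?C (pderiv Q))"
    by (simp only: shift_poly_fps_mult shift_poly_fps_add shift_poly_fps_smult
        fps_compose_mult_distrib[OF T0] fps_compose_add_distrib fps_const_compose)
  moreover have "fps_deriv (?C Q * ?E) = ?C \<phi> * (fps_const v * ?C Q + ?C (pderiv Q)) * ?E"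
    unfolding fps_deriv_mult deriv_E deriv_C by (simp only: distrib_left distrib_right mult_ac add_ac)
  ultimately show ?case
    unfolding fps_nth_deriv_commute Suc.IH diagram_poly_Suc[OF assms(1)] Q_def[symmetric] by (simp only:)
qed

lemma diagram_egf_eq_exp_flow:
  assumes "degree \<phi> \<le> R" and T0: "fps_nth T 0 = 0"
    and T': "fps_deriv T = fps_compose (shift_poly_fps \<phi> u) T"
  shows "diagram_egf \<phi> R u v = fps_compose (fps_exp 1) (fps_const v * T)"
proof (rule fps_ext)
  fix n
  let ?H = "fps_compose (fps_exp 1) (fps_const v * T)"
  have "fps_nth (fps_nth_deriv n ?H) 0 = poly (diagram_poly \<phi> R v n) u"
    unfolding fps_nth_deriv_exp_flow[OF assms] by (simp add: shift_poly_fps_nth_0)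
  moreover have "fps_nth (fps_nth_deriv n ?H) 0 = fact n * fps_nth ?H n"
    by (simp add: fps_deriv_maclauren_0)
  ultimately show "fps_nth (diagram_egf \<phi> R u v) n = fps_nth ?H n"
    by (simp add: diagram_egf_nth field_simps)
qed

section \<open>The primitive and its compositional inverse\<close>

text \<open>
  On a disc around \<open>u\<close> that is free of zeros of \<open>\<phi>\<close>, the function \<open>1 / \<phi>\<close> has a primitive \<open>g\<close>, and
  there \<open>\<Phi>\<close> differs from \<open>g\<close> by a constant: the initial path contributes a fixed number, and the final
  segment from \<open>u\<close> to \<open>y\<close> contributes \<open>g(y) - g(u)\<close>.
\<close>

lemma Phi_has_field_derivative:
  assumes "valid_path \<gamma>" "pathfinish \<gamma> = u" and nz: "\<forall>\<tau>\<in>path_image \<gamma>. poly \<phi> \<tau> \<noteq> 0"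
  obtains r where "r > 0" and "\<And>y. y \<in> ball u r \<Longrightarrow> poly \<phi> y \<noteq> 0" and
    "\<And>y. y \<in> ball u r \<Longrightarrow> (Phi \<phi> \<gamma> has_field_derivative 1 / poly \<phi> y) (at y)"
proof -
  let ?f = "\<lambda>\<tau>. 1 / poly \<phi> \<tau>"
  have "open {y. poly \<phi> y \<noteq> 0}"
    by (intro open_Collect_neq continuous_intros)
  moreover have "poly \<phi> u \<noteq> 0"
    using nz assms(2) pathfinish_in_path_image by blast
  ultimately obtain r where r: "r > 0" "ball u r \<subseteq> {y. poly \<phi> y \<noteq> 0}"
    by (metis (mono_tags) mem_Collect_eq open_contains_ball)
  have hol: "?f holomorphic_on ball u r"
    using r by (intro holomorphic_intros) auto
  then obtain g where g: "\<And>y. y \<in> ball u r \<Longrightarrow> (g has_field_derivative ?f y) (at y within ball u r)"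
    using holomorphic_convex_primitive'[OF convex_ball open_ball] by metis
  have int\<gamma>: "?f contour_integrable_on \<gamma>"
  proof (rule contour_integrable_holomorphic_simple[OF _ \<open>open {y. poly \<phi> y \<noteq> 0}\<close> assms(1)])
    show "?f holomorphic_on {y. poly \<phi> y \<noteq> 0}" by (intro holomorphic_intros) auto
  qed (use nz in auto)
  have Phi_eq: "Phi \<phi> \<gamma> y = contour_integral \<gamma> ?f + (g y - g u)" if y: "y \<in> ball u r" for y
  proof -
    have "path_image (linepath u y) \<subseteq> ball u r"
      using y r(1) by (simp add: closed_segment_subset)
    then have "(?f has_contour_integral (g y - g u)) (linepath u y)"
      using contour_integral_primitive[of "ball u r" g ?f "linepath u y"] g by simp
    then have "?f contour_integrable_on linepath u y"
      and "contour_integral (linepath u y) ?f = g y - g u"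
      by (auto simp: contour_integrable_on_def contour_integral_unique)
    then show ?thesis
      unfolding Phi_def assms(2) using assms(1,2) int\<gamma> by (subst contour_integral_join) auto
  qed
  show thesis
  proof (rule that[OF r(1)])
    fix y assume y: "y \<in> ball u r"
    show "poly \<phi> y \<noteq> 0" using y r(2) by auto
    have "(g has_field_derivative ?f y) (at y)"
      using g[OF y] by (simp only: at_within_open[OF y open_ball])
    then have "((\<lambda>y. contour_integral \<gamma> ?f + (g y - g u)) has_field_derivative 0 + (?f y - 0)) (at y)"
      by (intro DERIV_add DERIV_diff DERIV_const)
    then show "(Phi \<phi> \<gamma> has_field_derivative ?f y) (at y)"
      unfolding add_0 diff_0_right
      by (rule has_field_derivative_transform_within_open[OF _ open_ball y]) (simp only: Phi_eq)
  qed
qed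

text \<open>
  This is \<open>\<Phi>' = 1 / \<phi>\<close> for the Taylor series at \<open>u\<close>. The product form avoids an inverse of power
  series and is preserved as it stands by composition with \<open>T\<close>.
\<close>

lemma fps_deriv_Phi_expansion:
  assumes "valid_path \<gamma>" "pathfinish \<gamma> = u" and nz: "\<forall>\<tau>\<in>path_image \<gamma>. poly \<phi> \<tau> \<noteq> 0"
  shows "fps_deriv (fps_expansion (Phi \<phi> \<gamma>) u) * shift_poly_fps \<phi> u = 1"
proof -
  obtain r where r: "r > 0" and nz_ball: "\<And>y. y \<in> ball u r \<Longrightarrow> poly \<phi> y \<noteq> 0" and
    der: "\<And>y. y \<in> ball u r \<Longrightarrow> (Phi \<phi> \<gamma> has_field_derivative 1 / poly \<phi> y) (at y)"
    using Phi_has_field_derivative[OF assms] by metis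
  let ?F = "fps_expansion (Phi \<phi> \<gamma>) u"
  have "Phi \<phi> \<gamma> holomorphic_on ball u r"
    using der unfolding holomorphic_on_open[OF open_ball] by blast
  then have "Phi \<phi> \<gamma> analytic_on {u}"
    using r by (meson analytic_at open_ball centre_in_ball)
  then have "(\<lambda>x. Phi \<phi> \<gamma> (u + x)) has_fps_expansion ?F"
    by (rule analytic_at_imp_has_fps_expansion)
  then have exp: "(\<lambda>x. deriv (\<lambda>x. Phi \<phi> \<gamma> (u + x)) x * poly \<phi> (u + x)) has_fps_expansion
                  fps_deriv ?F * shift_poly_fps \<phi> u"
    by (intro has_fps_expansion_mult has_fps_expansion_deriv has_fps_expansion_shift_poly_fps)
  have "eventually (\<lambda>x. x \<in> ball 0 r) (nhds (0::complex))"
    using r by (intro eventually_nhds_in_open) auto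
  then have "eventually (\<lambda>x. deriv (\<lambda>x. Phi \<phi> \<gamma> (u + x)) x * poly \<phi> (u + x) = 1) (nhds 0)"
  proof eventually_elim
    case (elim x)
    have "u + x \<in> ball u r" using elim by (simp add: dist_norm)
    from der[OF this]
    have "((\<lambda>x. Phi \<phi> \<gamma> (u + x)) has_field_derivative 1 / poly \<phi> (u + x)) (at x)"
      by (simp only: DERIV_shift add.commute[of u])
    then show ?case using nz_ball[OF \<open>u + x \<in> ball u r\<close>] by (simp add: DERIV_imp_deriv)
  qed
  then have "(\<lambda>_. 1) has_fps_expansion fps_deriv ?F * shift_poly_fps \<phi> u"
    using exp by (simp only: has_fps_expansion_cong[OF _ refl])
  then show ?thesis
    by (rule fps_expansion_unique_complex[OF _ has_fps_expansion_1])
qed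

lemma ex1_fps_right_inverse:
  fixes f :: "'a::field fps"
  assumes "fps_nth f 0 = 0" "fps_nth f 1 \<noteq> 0"
  shows "\<exists>!T. fps_nth T 0 = 0 \<and> fps_compose f T = fps_X"
proof (rule ex1I[of _ "fps_inv f"])
  show "fps_nth (fps_inv f) 0 = 0 \<and> fps_compose f (fps_inv f) = fps_X"
    using fps_inv_right[OF assms] by (simp add: fps_inv_def)
next
  fix T assume T: "fps_nth T 0 = 0 \<and> fps_compose f T = fps_X"
  have "T = fps_compose (fps_compose (fps_inv f) f) T"
    using T by (simp add: fps_inv[OF assms])
  also have "\<dots> = fps_compose (fps_inv f) (fps_compose f T)"
    using T assms by (intro fps_compose_assoc[symmetric]) auto
  finally show "T = fps_inv f" using T by simp
qed

theorem proposition11: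
  fixes \<phi> :: "complex poly" and R :: nat and y0 :: real
    and \<gamma> :: "real \<Rightarrow> complex" and u v :: complex
  assumes "\<phi> \<noteq> 0" and "degree \<phi> \<le> R"
    and "y0 \<ge> 0" and "poly \<phi> (of_real y0) \<noteq> 0"
    and "valid_path \<gamma>" and "pathstart \<gamma> = of_real y0" and "pathfinish \<gamma> = u"
    and "\<forall>\<tau>\<in>path_image \<gamma>. poly \<phi> \<tau> \<noteq> 0"
  shows "(\<exists>!T. is_T \<phi> \<gamma> u T) \<and>
    (\<forall>T. is_T \<phi> \<gamma> u T \<longrightarrow>
       diagram_egf \<phi> R u v = fps_compose (fps_exp 1) (fps_const v * T))"
proof (intro conjI allI impI)
  define F where "F = fps_expansion (Phi \<phi> \<gamma>) u"
  define f where "f = F - fps_const (Phi \<phi> \<gamma> u)"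
  have deriv_f: "fps_deriv f * shift_poly_fps \<phi> u = 1"
    using fps_deriv_Phi_expansion[OF assms(5,7,8)] by (simp add: f_def F_def)
  have is_T_iff: "is_T \<phi> \<gamma> u T \<longleftrightarrow> fps_nth T 0 = 0 \<and> fps_compose f T = fps_X" for T
    by (simp add: is_T_def f_def F_def fps_compose_sub_distrib)
  have "fps_nth f 0 = 0"
    by (simp add: f_def F_def fps_expansion_def)
  moreover have "fps_nth f 1 \<noteq> 0"
    using arg_cong[OF deriv_f, of "\<lambda>g. fps_nth g 0"] by auto
  ultimately show "\<exists>!T. is_T \<phi> \<gamma> u T"
    unfolding is_T_iff by (rule ex1_fps_right_inverse)
  fix T assume "is_T \<phi> \<gamma> u T"
  then have T0: "fps_nth T 0 = 0" and fT: "fps_compose f T = fps_X"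
    by (simp_all add: is_T_iff)
  \<comment> \<open>The flow equation: multiply \<open>(f' \<circ> T) \<sqdot> T' = 1\<close> by \<open>\<phi>(u + T)\<close>.\<close>
  have "fps_deriv T = fps_deriv T * fps_compose (fps_deriv f * shift_poly_fps \<phi> u) T"
    by (simp add: deriv_f)
  also have "\<dots> = fps_deriv (fps_compose f T) * fps_compose (shift_poly_fps \<phi> u) T"
    by (simp add: fps_compose_deriv[OF T0] fps_compose_mult_distrib[OF T0] mult_ac)
  finally have "fps_deriv T = fps_compose (shift_poly_fps \<phi> u) T"
    by (simp add: fT)
  then show "diagram_egf \<phi> R u v = fps_compose (fps_exp 1) (fps_const v * T)"
    by (rule diagram_egf_eq_exp_flow[OF assms(2) T0])
qed

end
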